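(* Let $P$ be a finite poset, let $n\ge 4$ be odd, and assume $\frac{|P|+h(P)}{2}$ is an integer. Let $\mathcal{F}$ be an intersecting $P$-free family of subsets of $[n]$. Then \[ |\mathcal{F}|\le \sum_{i=1}^{\frac{|P|+h(P)}{2}-1}\binom{n}{\lfloor n/2\rfloor+i}. \]
   Context: $[n]=\{1,\dots,n\}$. A family is intersecting if any two of its members have nonempty intersection. A poset $P$ is a subposet of a poset $Q$ if there is an injection $\phi:P\to Q$ such that $x\le y$ in $P$ implies $\phi(x)\le\phi(y)$ in $Q$ (the converse is not required). A family $\mathcal{F}$ of sets, viewed as a poset under inclusion, is $P$-free if it does not contain $P$ as a subposet. $h(P)$ is the height of $P$, i.e. the size of a longest chain in $P$. *)

theory Defs
  imports Complex_Main
begin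

text \<open>
  A poset is a carrier \<open>A\<close> with a relation \<open>r\<close> such that \<open>partial_order_on A r\<close>;
  this includes \<open>r \<subseteq> A \<times> A\<close>.
\<close>

text \<open>
  Weak subposet relation: the injection preserves the order but need not reflect it.
\<close>

definition subposet :: "'a set \<Rightarrow> 'a rel \<Rightarrow> 'b set \<Rightarrow> 'b rel \<Rightarrow> bool" where
  "subposet A r B s \<longleftrightarrow>
    (\<exists>\<phi>. inj_on \<phi> A \<and> \<phi> ` A \<subseteq> B \<and>
      (\<forall>x\<in>A. \<forall>y\<in>A. (x, y) \<in> r \<longrightarrow> (\<phi> x, \<phi> y) \<in> s))"

definition poset_free :: "'a set \<Rightarrow> 'a rel \<Rightarrow> 'b set set \<Rightarrow> bool" where
  "poset_free A r F \<longleftrightarrow> \<not> subposet A r F (relation_of (\<subseteq>) F)"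

text \<open>
  For \<open>partial_order_on A r\<close> every member of \<open>Chains r\<close> is a subset of \<open>A\<close>, so for finite \<open>A\<close>
  the maximum ranges over a finite set, which is nonempty since it contains \<open>card {}\<close>.
\<close>

definition poset_height :: "'a rel \<Rightarrow> nat" where
  "poset_height r = Max (card ` Chains r)"

text \<open>
  The two members may coincide, so an intersecting family does not contain the empty set.
\<close>

definition intersecting :: "'b set set \<Rightarrow> bool" where
  "intersecting F \<longleftrightarrow> (\<forall>X\<in>F. \<forall>Y\<in>F. X \<inter> Y \<noteq> {})"

end

theory Submission
  imports Defs "HOL-Combinatorics.Permutations"
begin

text \<open>
  Method of double chains (Burcsi and Nagy). A double chain consists of the initial segments
  \<open>L i = {x\<^sub>1,\<dots>,x\<^sub>i}\<close> of a permutation together with the sets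
  \<open>M i = {x\<^sub>1,\<dots>,x\<^bsub>i-1\<^esub>,x\<^bsub>i+1\<^esub>}\<close>. The only incomparable pairs are
  \<open>(L i, M i)\<close> and \<open>(M i, M (i+1))\<close>, so placing the antichains of minimal elements of \<open>P\<close> one
  after the other, and skipping one set each time, embeds \<open>P\<close> into any \<open>|P| + h(P) - 1\<close> members
  of a double chain. Averaging over all permutations gives a LYM inequality with right-hand side
  \<open>K = (|P| + h(P)) / 2 - 1\<close>, up to a factor for the full set, which lies on only one of the two
  chains. Since an intersecting family never contains both a set and its complement, the levels
  \<open>k\<close> and \<open>n - k\<close> together hold at most \<open>n choose k\<close> members, and the resulting linear program
  is maximised by the \<open>K\<close> lowest levels above the middle.
\<close>

section \<open>Embedding posets into a double chain\<close>

text \<open>Position \<open>2 * i\<close> stands for \<open>L i\<close> and position \<open>2 * i + 1\<close> for \<open>M i\<close>.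
  There is no \<open>M 0\<close>, so position \<open>1\<close> is excluded where it matters.\<close>

definition double_chain_less :: "nat \<Rightarrow> nat \<Rightarrow> bool" where
  "double_chain_less p q \<longleftrightarrow> p < q \<and> \<not> (even p \<and> q = p + 1) \<and> \<not> (odd p \<and> q = p + 2)"

lemma finite_initial_subset:
  fixes T :: "'b::linorder set"
  assumes "finite T" "a \<le> card T"
  shows "\<exists>B\<subseteq>T. card B = a \<and> (\<forall>b\<in>B. \<forall>c\<in>T - B. b < c)"
  using assms
proof (induction a)
  case 0
  then show ?case by (intro exI[of _ "{}"]) auto
next
  case (Suc a)
  then obtain B where B: "B \<subseteq> T" "card B = a" "\<forall>b\<in>B. \<forall>c\<in>T - B. b < c"
    by auto
  have fin: "finite B" "finite (T - B)"
    using B(1) Suc.prems(1) finite_subset by auto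
  have "T - B \<noteq> {}"
    using Suc.prems B fin(1) card_mono[of B T] by auto
  then have m: "Min (T - B) \<in> T - B" "\<forall>c\<in>T - B. Min (T - B) \<le> c"
    using fin(2) Min_in[of "T - B"] by (blast, simp)
  have "\<forall>b\<in>insert (Min (T - B)) B. \<forall>c\<in>T - insert (Min (T - B)) B. b < c"
    using B(3) m by (auto simp: order.strict_iff_order)
  moreover have "card (insert (Min (T - B)) B) = Suc a"
    using B(2) m(1) fin(1) by simp
  moreover have "insert (Min (T - B)) B \<subseteq> T"
    using B(1) m(1) by auto
  ultimately show ?case by blast
qed

text \<open>Only the last position \<open>p\<close> of an initial segment matters: beyond
  \<open>p\<close> a single position is not above the whole segment. Giving up that position is the
  loss of one in the count.\<close>

lemma double_chain_split:
  assumes "finite T" "a \<le> card T"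
  shows "\<exists>B C. B \<subseteq> T \<and> C \<subseteq> T \<and> card B = a \<and> card T \<le> a + card C + 1 \<and>
    (\<forall>b\<in>B. \<forall>c\<in>C. double_chain_less b c)"
proof -
  obtain B where B: "B \<subseteq> T" "card B = a" "\<forall>b\<in>B. \<forall>c\<in>T - B. b < c"
    using finite_initial_subset[OF assms] by blast
  have fin: "finite B" using B(1) assms(1) finite_subset by blast
  define p where "p = Max B"
  \<comment> \<open>Besides \<open>p\<close> itself, only an odd \<open>b = p - 1\<close> can be
    unrelated to a position beyond \<open>p\<close>. That position is \<open>b + 2 = p + 1\<close>,
    again \<open>e\<close>, as \<open>p\<close> is then even. For empty \<open>B\<close> the value
    of \<open>p\<close> is arbitrary, but still at most one position is dropped.\<close>
  define e where "e = (if even p then p + 1 else p + 2)"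
  have less: "double_chain_less b c" if b: "b \<in> B" and c: "c \<in> T - B - {e}" for b c
  proof -
    have "b \<le> p" using b fin by (simp add: p_def)
    moreover have "p < c" using b c B(3) fin Max_in[of B] unfolding p_def by blast
    moreover have "c \<noteq> e" using c by simp
    ultimately have "b < c" "even b \<longrightarrow> c \<noteq> b + 1" "odd b \<longrightarrow> c \<noteq> b + 2"
      unfolding e_def by presburger+
    then show ?thesis by (auto simp: double_chain_less_def)
  qed
  have "card (T - B) = card T - a"
    using B(1,2) fin by (simp add: card_Diff_subset)
  then have "card T \<le> a + card (T - B - {e}) + 1"
    using assms by (auto simp: card_Diff_singleton_if)
  then show ?thesis
    using B(1,2) less by (intro exI[of _ B] exI[of _ "T - B - {e}"]) auto
qed

lemma finite_chain_least:
  assumes "partial_order_on U r" "finite C" "C \<noteq> {}" "C \<in> Chains r"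
  shows "\<exists>m\<in>C. \<forall>x\<in>C. (m, x) \<in> r"
  using assms(2-4)
proof (induction C rule: finite_ne_induct)
  case (singleton x)
  then show ?case by (auto simp: Chains_def)
next
  case (insert x C)
  then obtain m where m: "m \<in> C" "\<forall>y\<in>C. (m, y) \<in> r"
    by (auto simp: Chains_def)
  have "trans r" using assms(1) by (simp add: partial_order_on_def preorder_on_def)
  moreover have "(x, m) \<in> r \<or> (m, x) \<in> r" "(x, x) \<in> r"
    using insert.prems m(1) by (auto simp: Chains_def)
  ultimately show ?case
    using m by (blast dest: transD)
qed

text \<open>Induction on the bound \<open>h\<close> for chain sizes. The minimal elements take the
  first positions and one more is skipped. Their removal shortens every chain bound by one, so
  \<open>card A + h\<close> falls by one more than the number of minimal elements, exactly the
  positions spent.\<close>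

lemma poset_embeds_in_double_chain:
  assumes po: "partial_order_on U r"
    and "finite A" "A \<subseteq> U" "finite T"
    and "\<And>C. C \<subseteq> A \<Longrightarrow> C \<in> Chains r \<Longrightarrow> card C \<le> h"
    and "card A + h \<le> card T + 1"
  shows "\<exists>\<phi>. inj_on \<phi> A \<and> \<phi> ` A \<subseteq> T \<and>
    (\<forall>x\<in>A. \<forall>y\<in>A. (x, y) \<in> r \<longrightarrow> x \<noteq> y \<longrightarrow> double_chain_less (\<phi> x) (\<phi> y))"
  using assms(2-6)
proof (induction h arbitrary: A T)
  case 0
  have "x \<notin> A" for x
  proof
    assume x: "x \<in> A"
    then have "(x, x) \<in> r"
      using po 0 by (auto simp: partial_order_on_def preorder_on_def refl_on_def)
    then have "card {x} \<le> 0" using x by (intro 0) (auto simp: Chains_def)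
    then show False by simp
  qed
  then have "A = {}" by blast
  then show ?case by simp
next
  case (Suc h)
  have tr: "trans r" and anti: "antisym r"
    using po by (auto simp: partial_order_on_def preorder_on_def)
  have refl: "(x, x) \<in> r" if "x \<in> A" for x
    using that po Suc.prems(2) by (auto simp: partial_order_on_def preorder_on_def refl_on_def)
  define M where "M = {x \<in> A. \<forall>y\<in>A. (y, x) \<in> r \<longrightarrow> y = x}"
  have MA: "M \<subseteq> A" by (auto simp: M_def)
  have finM: "finite M" using MA Suc.prems(1) finite_subset by blast
  have "card M \<le> card T"
    using card_mono[OF Suc.prems(1) MA] Suc.prems(5) by simp
  then obtain B D where BD: "B \<subseteq> T" "D \<subseteq> T" "card B = card M" "card T \<le> card M + card D + 1"
    "\<forall>b\<in>B. \<forall>c\<in>D. double_chain_less b c"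
    using double_chain_split[OF Suc.prems(3)] by metis
  have chains: "card C \<le> h" if C: "C \<subseteq> A - M" "C \<in> Chains r" for C
  proof (cases "C = {}")
    case False
    have fin: "finite C" using C(1) Suc.prems(1) by (meson finite_Diff finite_subset)
    obtain m where m: "m \<in> C" "\<forall>x\<in>C. (m, x) \<in> r"
      using finite_chain_least[OF po fin False C(2)] by blast
    \<comment> \<open>The least element of \<open>C\<close> is not minimal in \<open>A\<close>, so
      \<open>C\<close> can be prolonged downwards; the longer chain obeys the bound
      \<open>Suc h\<close>.\<close>
    obtain y where y: "y \<in> A" "(y, m) \<in> r" "y \<noteq> m"
      using m(1) C(1) by (auto simp: M_def)
    have "y \<notin> C" using m y anti by (meson antisymD)
    moreover have "\<forall>x\<in>C. (y, x) \<in> r" using m y tr by (meson transD)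
    then have "insert y C \<in> Chains r"
      using C(2) refl[OF y(1)] by (auto simp: Chains_def)
    then have "card (insert y C) \<le> Suc h"
      using C(1) y(1) by (intro Suc.prems(4)) auto
    ultimately show ?thesis using fin by simp
  qed simp
  have "card (A - M) + h \<le> card D + 1"
    using BD(4) Suc.prems(5) card_Diff_subset[OF finM MA] card_mono[OF Suc.prems(1) MA] by simp
  moreover have "finite (A - M)" "A - M \<subseteq> U" "finite D"
    using Suc.prems(1-3) BD(2) finite_subset by auto
  ultimately obtain \<phi> where \<phi>: "inj_on \<phi> (A - M)" "\<phi> ` (A - M) \<subseteq> D"
    "\<forall>x\<in>A - M. \<forall>y\<in>A - M. (x, y) \<in> r \<longrightarrow> x \<noteq> y \<longrightarrow> double_chain_less (\<phi> x) (\<phi> y)"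
    using Suc.IH[of "A - M" D] chains by auto
  have finB: "finite B" using BD(1) Suc.prems(3) finite_subset by blast
  obtain \<psi> where \<psi>: "bij_betw \<psi> M B"
    using finite_same_card_bij[OF finM finB] BD(3) by auto
  define \<chi> where "\<chi> = (\<lambda>x. if x \<in> M then \<psi> x else \<phi> x)"
  have \<chi>M: "\<chi> x \<in> B" if "x \<in> M" for x
    using that \<psi> by (auto simp: \<chi>_def bij_betw_def)
  have \<chi>N: "\<chi> x \<in> D" if "x \<in> A - M" for x
    using that \<phi>(2) by (auto simp: \<chi>_def)
  have "B \<inter> D = {}" using BD(5) by (auto simp: double_chain_less_def)
  moreover have "inj_on \<chi> M"
    using bij_betw_imp_inj_on[OF \<psi>]
    by (rule inj_on_cong[THEN iffD1, rotated]) (simp add: \<chi>_def)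
  moreover have "inj_on \<chi> (A - M)"
    using \<phi>(1) by (rule inj_on_cong[THEN iffD1, rotated]) (simp add: \<chi>_def)
  ultimately have "inj_on \<chi> (M \<union> (A - M))"
    using image_subsetI[of M \<chi> B] image_subsetI[of "A - M" \<chi> D] \<chi>M \<chi>N
    unfolding inj_on_Un by blast
  then have "inj_on \<chi> A" using MA by (simp add: Un_absorb1)
  moreover have "\<chi> ` A \<subseteq> T" using \<chi>M \<chi>N BD(1,2) by blast
  moreover have "double_chain_less (\<chi> x) (\<chi> y)"
    if xy: "x \<in> A" "y \<in> A" "(x, y) \<in> r" "x \<noteq> y" for x y
  proof -
    \<comment> \<open>Something lies strictly below \<open>y\<close>, so no relation to check ends
      in \<open>M\<close>.\<close>
    have y: "y \<in> A - M" using xy by (auto simp: M_def)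
    show ?thesis
    proof (cases "x \<in> M")
      case True
      then show ?thesis using BD(5) \<chi>M \<chi>N y by blast
    next
      case False
      then show ?thesis using \<phi>(3) xy y by (auto simp: \<chi>_def)
    qed
  qed
  ultimately show ?case by blast
qed

text \<open>The double chain of the identity permutation; the others are its images. At position
  \<open>1\<close> the formula gives \<open>{1}\<close>, which repeats position \<open>2\<close> and
  has the wrong size for level \<open>0\<close>.\<close>

definition double_chain :: "nat \<Rightarrow> nat set" where
  "double_chain p = (if even p then {1..p div 2} else insert (p div 2 + 1) {1..<p div 2})"

lemma card_double_chain: "p \<noteq> 1 \<Longrightarrow> card (double_chain p) = p div 2"
  by (cases "even p") (auto simp: double_chain_def elim!: oddE)

lemma double_chain_subset: "p \<le> 2 * n \<Longrightarrow> double_chain p \<subseteq> {1..n}"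
  by (auto simp: double_chain_def elim!: oddE evenE)

lemma inj_on_double_chain: "inj_on double_chain (- {1})"
proof (rule inj_onI)
  fix p q assume pq: "p \<in> - {1}" "q \<in> - {1}" "double_chain p = double_chain q"
  then have eq: "p div 2 = q div 2" using card_double_chain by (metis ComplD insertI1)
  \<comment> \<open>The size determines \<open>p div 2\<close>; the element just past it then tells
    the two chains apart.\<close>
  have "p div 2 + 1 \<in> double_chain p \<longleftrightarrow> odd p" "q div 2 + 1 \<in> double_chain q \<longleftrightarrow> odd q"
    by (auto simp: double_chain_def)
  then have "odd p \<longleftrightarrow> odd q" using pq(3) eq by simp
  then show "p = q" using eq by (metis bit_eq_rec)
qed

lemma double_chain_mono: "double_chain_less p q \<Longrightarrow> double_chain p \<subseteq> double_chain q"
  by (auto simp: double_chain_def double_chain_less_def elim!: oddE evenE) presburger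

section \<open>Averaging over permutations\<close>

lemma ex_permutes_image:
  assumes "finite U" "X \<subseteq> U" "Y \<subseteq> U" "card X = card Y"
  shows "\<exists>\<sigma>. \<sigma> permutes U \<and> \<sigma> ` X = Y"
proof -
  have fin: "finite X" "finite Y" using assms finite_subset by auto
  obtain f where f: "bij_betw f X Y"
    using finite_same_card_bij[OF fin assms(4)] by auto
  have "card (U - X) = card (U - Y)" using assms fin by (simp add: card_Diff_subset)
  then obtain g where g: "bij_betw g (U - X) (U - Y)"
    using finite_same_card_bij[of "U - X" "U - Y"] assms(1) by auto
  define \<sigma> where "\<sigma> = (\<lambda>x. if x \<in> X then f x else if x \<in> U then g x else x)"
  have 1: "bij_betw \<sigma> X Y" using f by (rule bij_betw_cong[THEN iffD1, rotated]) (simp add: \<sigma>_def)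
  have 2: "bij_betw \<sigma> (U - X) (U - Y)"
    using g by (rule bij_betw_cong[THEN iffD1, rotated]) (simp add: \<sigma>_def)
  have "bij_betw \<sigma> (X \<union> (U - X)) (Y \<union> (U - Y))"
    using 1 2 by (rule bij_betw_combine) auto
  then have "bij_betw \<sigma> U U" using assms(2,3) by (simp add: Un_absorb1)
  then have "\<sigma> permutes U"
    using assms(2) by (intro bij_imp_permutes) (auto simp: \<sigma>_def)
  then show ?thesis using 1 by (auto simp: bij_betw_def)
qed

lemma card_permutes_image_eq:
  assumes U: "finite U" and S: "S \<subseteq> U" and X: "X \<subseteq> U" "card X = card S"
  shows "card {\<pi>. \<pi> permutes U \<and> \<pi> ` S = X} * (card U choose card S) = fact (card U)"
proof -
  define N where "N Y = {\<pi>. \<pi> permutes U \<and> \<pi> ` S = Y}" for Y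
  define \<Y> where "\<Y> = {Y. Y \<subseteq> U \<and> card Y = card S}"
  have finN: "finite (N Y)" for Y
    using finite_permutations[OF U] by (simp add: N_def)
  have le: "card (N Y) \<le> card (N Z)" if "Y \<in> \<Y>" "Z \<in> \<Y>" for Y Z
  proof -
    obtain \<sigma> where \<sigma>: "\<sigma> permutes U" "\<sigma> ` Y = Z"
      using ex_permutes_image[of U Y Z] U \<open>Y \<in> \<Y>\<close> \<open>Z \<in> \<Y>\<close> by (auto simp: \<Y>_def)
    have "inj_on ((\<circ>) \<sigma>) (N Y)"
      using permutes_inj[OF \<sigma>(1)] by (intro inj_onI) (simp add: fun.inj_map_strong inj_def fun_eq_iff)
    moreover have "(\<circ>) \<sigma> ` N Y \<subseteq> N Z"
      using \<sigma> by (auto simp: N_def permutes_compose image_comp[symmetric])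
    ultimately show ?thesis using finN card_inj_on_le by blast
  qed
  have fin\<Y>: "finite \<Y>" using U by (simp add: \<Y>_def)
  have "{\<pi>. \<pi> permutes U} = (\<Union>Y\<in>\<Y>. N Y)"
  proof -
    have "\<pi> ` S \<in> \<Y>" if "\<pi> permutes U" for \<pi>
      using that S permutes_image[OF that] card_image[of \<pi> S] permutes_inj_on[OF that]
      by (auto simp: \<Y>_def)
    then show ?thesis by (auto simp: N_def)
  qed
  then have "fact (card U) = card (\<Union>Y\<in>\<Y>. N Y)"
    using card_permutations[OF refl U] by simp
  also have "\<dots> = (\<Sum>Y\<in>\<Y>. card (N Y))"
    using fin\<Y> finN by (intro card_UN_disjoint) (auto simp: N_def)
  also have "\<dots> = (\<Sum>Y\<in>\<Y>. card (N X))"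
    using le X by (intro sum.cong) (auto simp: \<Y>_def intro: le_antisym)
  also have "\<dots> = card (N X) * (card U choose card S)"
    using n_subsets[OF U, of "card S"] by (simp add: \<Y>_def)
  finally show ?thesis by (simp add: N_def)
qed

lemma card_permutes_image_in:
  assumes U: "finite U" and S: "S \<subseteq> U" and F: "F \<subseteq> Pow U"
  shows "real (card {\<pi>. \<pi> permutes U \<and> \<pi> ` S \<in> F}) =
    fact (card U) * (card {X \<in> F. card X = card S} / (card U choose card S))"
proof -
  define G where "G = {X \<in> F. card X = card S}"
  have finG: "finite G"
    using F U by (auto simp: G_def intro: finite_subset[of _ "Pow U"])
  have pos: "card U choose card S > 0" using card_mono[OF U S] by simp
  have "card (\<pi> ` S) = card S" if "\<pi> permutes U" for \<pi>
    using permutes_inj_on[OF that] by (rule card_image)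
  then have "{\<pi>. \<pi> permutes U \<and> \<pi> ` S \<in> F} = (\<Union>X\<in>G. {\<pi>. \<pi> permutes U \<and> \<pi> ` S = X})"
    by (auto simp: G_def)
  then have "card {\<pi>. \<pi> permutes U \<and> \<pi> ` S \<in> F} =
      card (\<Union>X\<in>G. {\<pi>. \<pi> permutes U \<and> \<pi> ` S = X})"
    by simp
  also have "\<dots> = (\<Sum>X\<in>G. card {\<pi>. \<pi> permutes U \<and> \<pi> ` S = X})"
    using finG finite_permutations[OF U] by (intro card_UN_disjoint) auto
  finally have "real (card {\<pi>. \<pi> permutes U \<and> \<pi> ` S \<in> F}) =
      (\<Sum>X\<in>G. real (card {\<pi>. \<pi> permutes U \<and> \<pi> ` S = X}))"
    by simp
  also have "\<dots> = (\<Sum>X\<in>G. fact (card U) / (card U choose card S))"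
  proof (intro sum.cong refl)
    fix X assume "X \<in> G"
    then have "card {\<pi>. \<pi> permutes U \<and> \<pi> ` S = X} * (card U choose card S) = fact (card U)"
      using card_permutes_image_eq[OF U S, of X] F by (auto simp: G_def)
    then have "real (card {\<pi>. \<pi> permutes U \<and> \<pi> ` S = X}) * real (card U choose card S) =
        fact (card U)"
      by (metis of_nat_mult of_nat_fact)
    then show "real (card {\<pi>. \<pi> permutes U \<and> \<pi> ` S = X}) =
        fact (card U) / (card U choose card S)"
      using pos by (simp add: field_simps)
  qed
  also have "\<dots> = fact (card U) * (card G / (card U choose card S))"
    by simp
  finally show ?thesis by (simp add: G_def)
qed

text \<open>One more member on the double chain would leave room for the embedding of the poset into
  positions, and \<open>\<pi>\<close> would turn it into a copy inside \<open>F\<close>. The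
  \<open>+ 2\<close> avoids truncated subtraction.\<close>

lemma poset_free_double_chain:
  assumes "finite A" "partial_order_on A r" "poset_free A r F" "inj \<pi>" "finite V" "1 \<notin> V"
  shows "card {p \<in> V. \<pi> ` double_chain p \<in> F} + 2 \<le> card A + poset_height r"
proof (rule ccontr)
  let ?T = "{p \<in> V. \<pi> ` double_chain p \<in> F}"
  assume "\<not> ?thesis"
  then have le: "card A + poset_height r \<le> card ?T + 1" by simp
  have "Chains r \<subseteq> Pow A"
    using assms(2) by (auto simp: Chains_def partial_order_on_def preorder_on_def refl_on_def)
  then have "finite (Chains r)" using assms(1) by (meson finite_Pow_iff finite_subset)
  then have "card C \<le> poset_height r" if "C \<in> Chains r" for C
    using that by (simp add: poset_height_def)
  then obtain \<phi> where \<phi>: "inj_on \<phi> A" "\<phi> ` A \<subseteq> ?T"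
    "\<forall>x\<in>A. \<forall>y\<in>A. (x, y) \<in> r \<longrightarrow> x \<noteq> y \<longrightarrow> double_chain_less (\<phi> x) (\<phi> y)"
    using poset_embeds_in_double_chain[OF assms(2,1) order_refl _ _ le] assms(5) by auto
  define \<theta> where "\<theta> x = \<pi> ` double_chain (\<phi> x)" for x
  have "\<phi> ` A \<subseteq> - {1}" using \<phi>(2) assms(6) by auto
  then have "inj_on double_chain (\<phi> ` A)" using inj_on_double_chain inj_on_subset by blast
  then have "inj_on \<theta> A"
    using \<phi>(1) assms(4) by (simp add: \<theta>_def inj_on_def inj_image_eq_iff)
  moreover have "\<theta> ` A \<subseteq> F" using \<phi>(2) by (auto simp: \<theta>_def)
  moreover have "\<theta> x \<subseteq> \<theta> y" if "x \<in> A" "y \<in> A" "(x, y) \<in> r" for x y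
  proof (cases "x = y")
    case False
    then have "double_chain_less (\<phi> x) (\<phi> y)" using that \<phi>(3) by blast
    then show ?thesis unfolding \<theta>_def by (intro image_mono double_chain_mono)
  qed simp
  ultimately have "subposet A r F (relation_of (\<subseteq>) F)"
    unfolding subposet_def relation_of_def by (intro exI[of _ \<theta>]) blast
  then show False using assms(3) by (simp add: poset_free_def)
qed

text \<open>Every level below \<open>n\<close> is met by two positions, level \<open>n\<close> only
  by \<open>2 * n\<close>. This is the origin of the smaller weight of the full set.\<close>

lemma sum_div2:
  fixes g :: "nat \<Rightarrow> real" and n :: nat
  shows "(\<Sum>p\<le>2 * n. g (p div 2)) = 2 * (\<Sum>k<n. g k) + g n"
  by (induction n) auto

lemma card_level_0:
  fixes F :: "nat set set"
  assumes "F \<subseteq> Pow {1..n}" "{} \<notin> F"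
  shows "{X \<in> F. card X = 0} = {}"
proof -
  have "card X \<noteq> 0" if "X \<in> F" for X
  proof -
    have "finite X" using that assms(1) finite_subset[of X "{1..n}"] by auto
    moreover have "X \<noteq> {}" using that assms(2) by blast
    ultimately show ?thesis by simp
  qed
  then show ?thesis by blast
qed

lemma poset_free_LYM:
  fixes F :: "nat set set" and g :: "nat \<Rightarrow> real"
  assumes "finite A" "partial_order_on A r" "F \<subseteq> Pow {1..n}" "{} \<notin> F" "poset_free A r F"
  defines "g \<equiv> \<lambda>k. card {X \<in> F. card X = k} / real (n choose k)"
  shows "2 * (\<Sum>k<n. g k) + g n + 2 \<le> card A + poset_height r"
proof -
  define V where "V = {..2 * n} - {1::nat}"
  define Q where "Q = {\<pi>. \<pi> permutes {1..n}}"
  have finQ: "finite Q" by (simp add: Q_def finite_permutations)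
  have cardQ: "card Q = fact n" unfolding Q_def by (rule card_permutations) auto
  have g0: "g 0 = 0" unfolding g_def card_level_0[OF assms(3,4)] by simp
  have "fact n * (2 * (\<Sum>k<n. g k) + g n) = fact n * (\<Sum>p\<le>2 * n. g (p div 2))"
    by (simp add: sum_div2)
  \<comment> \<open>The excluded position \<open>1\<close> would contribute \<open>g 0\<close>,
    which vanishes.\<close>
  also have "(\<Sum>p\<le>2 * n. g (p div 2)) = (\<Sum>p\<in>V. g (p div 2))"
    using g0 by (intro sum.mono_neutral_right) (auto simp: V_def)
  also have "fact n * \<dots> = (\<Sum>p\<in>V. real (card {\<pi> \<in> Q. \<pi> ` double_chain p \<in> F}))"
    unfolding sum_distrib_left
  proof (intro sum.cong refl)
    fix p assume "p \<in> V"
    then have "double_chain p \<subseteq> {1..n}" "card (double_chain p) = p div 2"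
      using double_chain_subset card_double_chain by (auto simp: V_def)
    then show "fact n * g (p div 2) = real (card {\<pi> \<in> Q. \<pi> ` double_chain p \<in> F})"
      using card_permutes_image_in[of "{1..n}" "double_chain p" F] assms(3) by (simp add: Q_def g_def)
  qed
  also have "\<dots> = (\<Sum>p\<in>V. \<Sum>\<pi>\<in>Q. of_bool (\<pi> ` double_chain p \<in> F))"
    using finQ by (simp add: sum.inter_filter[symmetric] of_bool_def)
  also have "\<dots> = (\<Sum>\<pi>\<in>Q. \<Sum>p\<in>V. of_bool (\<pi> ` double_chain p \<in> F))"
    by (rule sum.swap)
  also have "\<dots> = (\<Sum>\<pi>\<in>Q. real (card {p \<in> V. \<pi> ` double_chain p \<in> F}))"
    by (simp add: sum.inter_filter[symmetric] of_bool_def V_def)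
  also have "\<dots> \<le> (\<Sum>\<pi>\<in>Q. real (card A + poset_height r) - 2)"
  proof (rule sum_mono)
    fix \<pi> assume "\<pi> \<in> Q"
    then have "inj \<pi>" using permutes_inj by (auto simp: Q_def)
    then have "card {p \<in> V. \<pi> ` double_chain p \<in> F} + 2 \<le> card A + poset_height r"
      using poset_free_double_chain[OF assms(1,2,5), of \<pi> V] by (simp add: V_def)
    then show "real (card {p \<in> V. \<pi> ` double_chain p \<in> F}) \<le> real (card A + poset_height r) - 2"
      by linarith
  qed
  also have "\<dots> = fact n * (real (card A + poset_height r) - 2)"
    by (simp add: cardQ)
  finally show ?thesis by simp
qed

section \<open>Intersecting families\<close>

text \<open>Complementation maps the members on level \<open>n - k\<close> injectively into level
  \<open>k\<close>, and their images avoid \<open>F\<close> because a set is disjoint from its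
  complement.\<close>

lemma intersecting_level_pair:
  fixes F :: "nat set set"
  assumes "F \<subseteq> Pow {1..n}" "intersecting F" "k \<le> n"
  shows "card {X \<in> F. card X = k} + card {X \<in> F. card X = n - k} \<le> n choose k"
proof -
  define c where "c X = {1..n} - X" for X
  have cc: "c (c X) = X" if "X \<in> F" for X using that assms(1) by (auto simp: c_def)
  have nc: "c X \<notin> F" if "X \<in> F" for X
  proof -
    have "X \<inter> c X = {}" by (auto simp: c_def)
    then show ?thesis using that assms(2) unfolding intersecting_def by blast
  qed
  have finF: "finite F" using assms(1) finite_subset by auto
  have cardc: "card (c X) = n - card X" if "X \<in> F" for X
    using that assms(1) finite_subset[of X "{1..n}"] by (auto simp: c_def card_Diff_subset)
  let ?L = "{X \<in> F. card X = k}" and ?H = "{X \<in> F. card X = n - k}"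
  have "inj_on c ?H" using cc by (metis (no_types, lifting) inj_onI mem_Collect_eq)
  then have "card ?L + card ?H = card ?L + card (c ` ?H)" by (simp add: card_image)
  also have "\<dots> = card (?L \<union> c ` ?H)"
    using finF nc by (intro card_Un_disjoint[symmetric]) auto
  also have "\<dots> \<le> card {X. X \<subseteq> {1..n} \<and> card X = k}"
  proof (rule card_mono)
    show "?L \<union> c ` ?H \<subseteq> {X. X \<subseteq> {1..n} \<and> card X = k}"
      using assms(1,3) cardc by (auto simp: c_def)
  qed simp
  also have "\<dots> = n choose k" using n_subsets[of "{1..n}" k] by simp
  finally show ?thesis .
qed

section \<open>The linear program over pairs of complementary levels\<close>

lemma sum_fold_levels:
  "(\<Sum>k\<le>2 * d + 1. g k) = (\<Sum>i = 1..d + 1. g (d + i) + g (d + 1 - i))"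
  for g :: "nat \<Rightarrow> 'b::comm_monoid_add"
proof -
  have "(\<Sum>k\<le>2 * d + 1. g k) = (\<Sum>k\<le>d. g k) + (\<Sum>k = d + 1..2 * d + 1. g k)"
  proof -
    have "{..2 * d + 1} = {..d} \<union> {d + 1..2 * d + 1}" by auto
    then show ?thesis by (simp only:) (rule sum.union_disjoint; auto)
  qed
  also have "(\<Sum>k\<le>d. g k) = (\<Sum>i = 1..d + 1. g (d + 1 - i))"
    by (rule sum.reindex_bij_witness[of _ "\<lambda>i. d + 1 - i" "\<lambda>k. d + 1 - k"]) auto
  also have "(\<Sum>k = d + 1..2 * d + 1. g k) = (\<Sum>i = 1..d + 1. g (d + i))"
    by (rule sum.reindex_bij_witness[of _ "\<lambda>i. d + i" "\<lambda>k. k - d"]) auto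
  finally show ?thesis by (simp add: sum.distrib add.commute)
qed

theorem theorem12:
  fixes A :: "'a set" and r :: "'a rel" and n :: nat and F :: "nat set set"
  assumes "finite A" and "partial_order_on A r"
    and "n \<ge> 4" and "odd n"
    and "even (card A + poset_height r)"
    and "F \<subseteq> Pow {1..n}" and "intersecting F" and "poset_free A r F"
  shows "card F \<le> (\<Sum>i = 1..(card A + poset_height r) div 2 - 1. n choose (n div 2 + i))"
proof -
  define K where "K = (card A + poset_height r) div 2 - 1"
  obtain d where n: "n = 2 * d + 1" using assms(4) by (elim oddE)
  have ndiv: "n div 2 = d" by (simp add: n)
  define f where "f k = card {X \<in> F. card X = k}" for k
  define C where "C i = real (n choose (d + i))" for i
  \<comment> \<open>Levels \<open>d + i\<close> and \<open>d + 1 - i\<close> are complementary and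
    have the same binomial coefficient \<open>C i\<close>, so the program needs one variable per
    pair.\<close>
  define s where "s i = real (f (d + i) + f (d + 1 - i))" for i
  define g where "g k = f k / real (n choose k)" for k
  have "{} \<notin> F" using assms(7) by (auto simp: intersecting_def)
  then have LYM: "2 * (\<Sum>k<n. g k) + g n + 2 \<le> card A + poset_height r"
    using poset_free_LYM[OF assms(1,2,6) _ assms(8)] by (simp add: g_def f_def)
  \<comment> \<open>Nonnegativity forces \<open>card A + poset_height r\<close> to be at least
    \<open>2\<close>, so the subtraction in \<open>K\<close> is not truncated.\<close>
  have "g k \<ge> 0" for k by (simp add: g_def)
  then have "2 * (\<Sum>k<n. g k) + g n \<ge> 0" by (simp add: sum_nonneg)
  then have "2 \<le> card A + poset_height r" using LYM by linarith
  then have "card A + poset_height r = 2 * K + 2" using assms(5) unfolding K_def by presburger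
  then have LYM': "(\<Sum>k\<le>n. g k) - g n / 2 \<le> K" using LYM by (simp add: lessThan_Suc_atMost[symmetric])
  have Cpos: "C i > 0" if "i \<le> d + 1" for i using that by (simp add: C_def n)
  have s_le: "s i \<le> C i" if "i \<in> {1..d + 1}" for i
    using that intersecting_level_pair[OF assms(6,7), of "d + i"]
    by (simp add: s_def f_def C_def n flip: of_nat_add)
  have gg: "g (d + i) + g (d + 1 - i) = s i / C i" if "i \<in> {1..d + 1}" for i
    using that binomial_symmetric[of "d + i" n]
    by (simp add: g_def s_def C_def n add_divide_distrib)
  have finF: "finite F" using assms(6) finite_subset by auto
  have "card X \<le> n" if "X \<in> F" for X
    using that assms(6) card_mono[of "{1..n}" X] by auto
  then have "card ` F \<subseteq> {..n}" by auto
  then have "card F = (\<Sum>k\<le>n. f k)"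
    using sum.group[OF finF, of "{..n}" card "\<lambda>_. 1::nat"] by (auto simp: f_def)
  then have "real (card F) = (\<Sum>k\<le>n. real (f k))" by simp
  then have F_eq: "real (card F) = (\<Sum>i = 1..d + 1. s i)"
    by (simp only: n sum_fold_levels s_def of_nat_add)
  have "real (card F) \<le> (\<Sum>i = 1..K. C i)"
  \<comment> \<open>For \<open>K > d\<close> the pair bounds \<open>s i \<le> C i\<close> alone
    suffice; only the other case uses the LYM inequality.\<close>
  proof (cases "K \<le> d")
    case False
    have "real (card F) \<le> (\<Sum>i = 1..d + 1. C i)"
      unfolding F_eq using s_le by (intro sum_mono) auto
    also have "\<dots> \<le> (\<Sum>i = 1..K. C i)"
      using False by (intro sum_mono2) (auto simp: C_def)
    finally show ?thesis .
  next
    case True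
    txt \<open>The multiplier of the LYM constraint in the dual linear program.\<close>
    define c where "c = C K"
    have anti: "C j \<le> C i" if "i \<le> j" "j \<le> d + 1" for i j
      using that binomial_antimono[of "d + i" "d + j" n] by (simp add: C_def n)
    \<comment> \<open>The top pair has \<open>C i = 1\<close> and only half weight, so its term
      needs \<open>c / 2 \<ge> 1\<close>.\<close>
    have "c \<ge> C d" using True anti by (simp add: c_def)
    moreover have "C d = n" using binomial_symmetric[of "d + d" n] by (simp add: C_def n)
    ultimately have c2: "c \<ge> 2" using assms(3) by simp
    \<comment> \<open>The pair \<open>d + 1\<close> joins level \<open>n\<close> to the empty level
      \<open>0\<close>, so it inherits the half weight of \<open>g n\<close>.\<close>
    define w where "w i = (if i = d + 1 then 1 / 2 else 1 :: real)" for i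
    \<comment> \<open>Dual feasibility, term by term. For \<open>i \<le> K\<close> it is
      \<open>(C i - s i) * (C i - c) \<ge> 0\<close> divided by \<open>C i\<close>; for
      \<open>K < i \<le> d\<close> it follows from \<open>C i \<le> c\<close>. After summation
      \<open>K * c\<close> cancels against the LYM bound.\<close>
    have "s i \<le> (if i \<le> K then C i - c else 0) + c * (w i * (s i / C i))" if i: "i \<in> {1..d + 1}" for i
    proof -
      have s0: "s i \<ge> 0" and C0: "C i > 0" using Cpos i by (auto simp: s_def)
      consider "i \<le> K" | "K < i" "i \<le> d" | "K < i" "i = d + 1" using i by force
      then show ?thesis
      proof cases
        case 1
        then have "c \<le> C i" "w i = 1" using True anti by (auto simp: c_def w_def)
        then have "(C i - s i) * (C i - c) \<ge> 0" using s_le[OF i] by simp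
        then show ?thesis using 1 C0 \<open>w i = 1\<close> by (simp add: field_simps)
      next
        case 2
        then have "C i \<le> c" "w i = 1" using anti by (auto simp: c_def w_def)
        then show ?thesis using 2 C0 s0 mult_right_mono[OF \<open>C i \<le> c\<close> s0]
          by (simp add: field_simps)
      next
        case 3
        then have "d + i = n" "w i = 1 / 2" by (simp_all add: w_def n)
        then have "C i = 1" by (simp add: C_def)
        then show ?thesis using 3 mult_right_mono[OF c2 s0] unfolding \<open>w i = 1 / 2\<close> by simp
      qed
    qed
    then have "real (card F) \<le>
        (\<Sum>i = 1..d + 1. (if i \<le> K then C i - c else 0) + c * (w i * (s i / C i)))"
      unfolding F_eq by (intro sum_mono) auto
    also have "\<dots> = (\<Sum>i = 1..d + 1. if i \<le> K then C i - c else 0) + c * (\<Sum>i = 1..d + 1. w i * (s i / C i))"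
      by (simp only: sum.distrib sum_distrib_left)
    also have "(\<Sum>i = 1..d + 1. if i \<le> K then C i - c else 0) = (\<Sum>i = 1..K. C i - c)"
      using True by (intro sum.mono_neutral_cong_right) auto
    also have "\<dots> = (\<Sum>i = 1..K. C i) - K * c"
      by (simp add: sum_subtractf)
    also have "(\<Sum>i = 1..d + 1. w i * (s i / C i)) \<le> K"
    proof -
      have "g 0 = 0"
        unfolding g_def f_def card_level_0[OF assms(6) \<open>{} \<notin> F\<close>] by simp
      then have gn: "s (d + 1) / C (d + 1) = g n"
        using gg[of "d + 1"] by (simp add: n mult_2)
      have "(\<Sum>i = 1..d + 1. w i * (s i / C i)) =
          (\<Sum>i = 1..d + 1. s i / C i) - s (d + 1) / C (d + 1) / 2"
        by (simp add: w_def)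
      also have "(\<Sum>i = 1..d + 1. s i / C i) = (\<Sum>k\<le>n. g k)"
        unfolding n sum_fold_levels using gg by (intro sum.cong) auto
      finally show ?thesis using LYM' gn by simp
    qed
    finally show ?thesis using c2 by (simp add: mult.commute)
  qed
  also have "\<dots> = real (\<Sum>i = 1..K. n choose (d + i))" by (simp add: C_def)
  finally show ?thesis by (simp only: K_def ndiv of_nat_le_iff)
qed

end
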